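(* Let $p,q$ be coprime positive integers and let $\phi\in\mathbb Z$ satisfy $\phi^p\equiv 1\pmod q$ and either $\gcd(\phi-1,q)=1$ or $\phi=1$. Then the group $$\mathbb Z_q\rtimes_\phi\mathbb Z_p=\langle a,A\mid a^q=1,\ A^p=1,\ AaA^{-1}=a^\phi\rangle$$ is effectively cyclic.
   Context: A finite group $G$ is called effectively cyclic if for every $g\in G$ and every $h$ in the centralizer $C_g$ of $g$ in $G$ there is a cyclic subgroup $C<G$ with $g,h\in C$. *)

theory Defs
  imports "HOL-Algebra.Algebra" "HOL-Number_Theory.Cong"
begin

definition centralizer :: "('a, 'm) monoid_scheme \<Rightarrow> 'a \<Rightarrow> 'a set" where
  "centralizer G g = {h \<in> carrier G. h \<otimes>\<^bsub>G\<^esub> g = g \<otimes>\<^bsub>G\<^esub> h}"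

text \<open>The subgroup \<open>C\<close> need not be proper: every finite cyclic group is effectively cyclic.\<close>

definition effectively_cyclic :: "('a, 'm) monoid_scheme \<Rightarrow> bool" where
  "effectively_cyclic G \<longleftrightarrow> group G \<and> finite (carrier G) \<and>
     (\<forall>g \<in> carrier G. \<forall>h \<in> centralizer G g.
        \<exists>C. subgroup C G \<and> cyclic_group (G\<lparr>carrier := C\<rparr>) \<and> g \<in> C \<and> h \<in> C)"

definition semidirect_product ::
  "('a, 'm) monoid_scheme \<Rightarrow> ('b, 'n) monoid_scheme \<Rightarrow> ('b \<Rightarrow> 'a \<Rightarrow> 'a) \<Rightarrow> ('a \<times> 'b) monoid" where
  "semidirect_product N H act =
     \<lparr>carrier = carrier N \<times> carrier H,
      monoid.mult = (\<lambda>(x, i) (y, j). (x \<otimes>\<^bsub>N\<^esub> act i y, i \<otimes>\<^bsub>H\<^esub> j)),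
      one = (\<one>\<^bsub>N\<^esub>, \<one>\<^bsub>H\<^esub>)\<rparr>"

text \<open>The generator of the second factor acts by multiplication by \<open>\<phi>\<close>. Elements of the
  second factor are represented by integers in \<open>{0..<p}\<close>, so that \<open>nat\<close> loses nothing; the action
  is a homomorphism into the automorphism group when \<open>\<phi> ^ p\<close> is congruent to 1 modulo \<open>q\<close>.\<close>

definition cyclic_semidirect :: "nat \<Rightarrow> nat \<Rightarrow> int \<Rightarrow> (int \<times> int) monoid" where
  "cyclic_semidirect q p \<phi> =
     semidirect_product (integer_mod_group q) (integer_mod_group p)
       (\<lambda>i x. (\<phi> ^ nat i * x) mod int q)"

text \<open>Group presentations. A letter \<open>(x, True)\<close> is the generator \<open>x\<close>, and \<open>(x, False)\<close> is its
  formal inverse; a pair \<open>(u, v)\<close> of words is the relation \<open>u = v\<close>. Every element of the type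
  \<open>'g\<close> is a generator.\<close>

type_synonym 'g word = "('g \<times> bool) list"

inductive word_eq :: "('g word \<times> 'g word) set \<Rightarrow> 'g word \<Rightarrow> 'g word \<Rightarrow> bool" for R where
  relation: "(u, v) \<in> R \<Longrightarrow> word_eq R u v"
| cancel: "word_eq R [(x, b), (x, \<not> b)] []"
| refl: "word_eq R u u"
| sym: "word_eq R u v \<Longrightarrow> word_eq R v u"
| trans: "word_eq R u v \<Longrightarrow> word_eq R v w \<Longrightarrow> word_eq R u w"
| append: "word_eq R u u' \<Longrightarrow> word_eq R v v' \<Longrightarrow> word_eq R (u @ v) (u' @ v')"

definition word_class :: "('g word \<times> 'g word) set \<Rightarrow> 'g word \<Rightarrow> 'g word set" where
  "word_class R u = {v. word_eq R u v}"

text \<open>The union in the product ranges over copies of one and the same class, since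
  \<open>word_eq R\<close> is a congruence.\<close>

definition presented_group :: "('g word \<times> 'g word) set \<Rightarrow> 'g word set monoid" where
  "presented_group R =
     \<lparr>carrier = range (word_class R),
      monoid.mult = (\<lambda>U V. \<Union>u\<in>U. \<Union>v\<in>V. word_class R (u @ v)),
      one = word_class R []\<rparr>"

definition word_pow :: "'g \<Rightarrow> int \<Rightarrow> 'g word" where
  "word_pow x n = (if 0 \<le> n then replicate (nat n) (x, True) else replicate (nat (- n)) (x, False))"

datatype generator = gen_a | gen_A

definition metacyclic_relations :: "nat \<Rightarrow> nat \<Rightarrow> int \<Rightarrow> (generator word \<times> generator word) set" where
  "metacyclic_relations q p \<phi> =
     {(word_pow gen_a (int q), []),
      (word_pow gen_A (int p), []),
      ([(gen_A, True), (gen_a, True), (gen_A, False)], word_pow gen_a \<phi>)}"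

end

theory Submission
  imports Defs
begin

text \<open>An abelian extension of a cyclic group by a cyclic group of coprime exponent is cyclic. Since
  \<open>p\<close> and \<open>q\<close> are coprime, this applies to every abelian subgroup of the semidirect product, and
  two commuting elements lie in an abelian subgroup, namely their double centralizer.
  The presentation is handled by the normal form \<open>a\<^sup>x A\<^sup>i\<close>: words can be evaluated in the
  semidirect product, which separates normal forms, and the normal forms are the image of a
  homomorphism whose range contains the generators.\<close>

section \<open>Cyclic groups\<close>

lemma (in group) cyclic_subgroup:
  assumes "subgroup H G"
  shows "cyclic_group (G\<lparr>carrier := H\<rparr>) \<longleftrightarrow> (\<exists>x\<in>H. H = range (\<lambda>n::int. x [^] n))"
proof -
  interpret H: group "G\<lparr>carrier := H\<rparr>"
    using assms by (rule subgroup_imp_group)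
  have "(\<lambda>n::int. x [^]\<^bsub>G\<lparr>carrier := H\<rparr>\<^esub> n) = (\<lambda>n. x [^] n)" if "x \<in> H" for x
    using int_pow_consistent[OF assms that] by simp
  then show ?thesis
    unfolding H.cyclic_group by (simp cong: bex_cong)
qed

text \<open>The exponents \<open>n\<close> with \<open>c [^] n\<close> in \<open>H\<close> form an
  ideal \<open>D\<close> of the integers. A generator \<open>d\<close> of this ideal yields the
  generator \<open>c [^] d\<close> of \<open>H\<close>. \<open>G\<close> may be infinite.\<close>

lemma (in group) subgroup_cyclic:
  assumes "cyclic_group G" and H: "subgroup H G"
  shows "cyclic_group (G\<lparr>carrier := H\<rparr>)"
proof -
  obtain c where c: "c \<in> carrier G" and G: "carrier G = range (\<lambda>n::int. c [^] n)"
    using assms(1) cyclic_group by blast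
  define D where "D = {n::int. c [^] n \<in> H}"
  have mult: "k * n \<in> D" if "n \<in> D" for k n
    using that c subgroup_int_pow_closed[OF H, of "c [^] n" k]
    by (simp add: D_def int_pow_pow mult.commute)
  have diff: "m - n \<in> D" if "m \<in> D" "n \<in> D" for m n
    using that c H by (simp add: D_def int_pow_diff subgroup.m_closed subgroup.m_inv_closed)
  \<comment> \<open>\<open>d\<close> is the least positive element of \<open>D\<close> if there is
    one; otherwise \<open>D\<close> is zero and \<open>d = 0\<close>.\<close>
  obtain d where d: "d \<in> D" and dvd: "\<And>n. n \<in> D \<Longrightarrow> d dvd n"
  proof (cases "\<exists>n\<in>D. n > 0")
    case True
    then have ex: "\<exists>n. n > 0 \<and> int n \<in> D"
      by (metis zero_less_imp_eq_int of_nat_0_less_iff)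
    define d where "d = (LEAST n. n > 0 \<and> int n \<in> D)"
    have d: "d > 0" "int d \<in> D"
      using LeastI_ex[OF ex] unfolding d_def by auto
    have "int d dvd n" if "n \<in> D" for n
    proof -
      \<comment> \<open>The remainder stays in \<open>D\<close> and is smaller than
        \<open>d\<close>, so minimality forces it to vanish.\<close>
      have "n mod int d \<in> D"
        using diff[OF that mult[OF d(2), of "n div int d"]] by (simp add: minus_div_mult_eq_mod)
      then have "int (nat (n mod int d)) \<in> D"
        using d(1) by simp
      moreover have "nat (n mod int d) < d"
        using d(1) by (simp add: nat_less_iff)
      ultimately have "nat (n mod int d) = 0"
        using not_less_Least[of "nat (n mod int d)" "\<lambda>n. n > 0 \<and> int n \<in> D"]
        unfolding d_def by auto
      then have "n mod int d \<le> 0" by simp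
      then have "n mod int d = 0"
        using d(1) pos_mod_sign[of "int d" n] by linarith
      then show ?thesis by auto
    qed
    then show thesis using that d(2) by blast
  next
    case False
    have zero: "0 \<in> D"
      using H by (simp add: D_def subgroup.one_closed)
    have "n = 0" if "n \<in> D" for n
      using that False diff[OF zero that] by (metis diff_0 neg_0_less_iff_less linorder_neqE)
    then show thesis using that zero by blast
  qed
  have "\<exists>n::int. x = (c [^] d) [^] n" if "x \<in> H" for x
  proof -
    have "x \<in> range (\<lambda>n::int. c [^] n)"
      using subgroup.mem_carrier[OF H that] by (simp only: G)
    then obtain n :: int where n: "x = c [^] n"
      by blast
    then have "d dvd n"
      using that by (intro dvd) (simp add: D_def)
    then obtain k where "n = d * k"
      by (rule dvdE)
    with n c show ?thesis by (metis int_pow_pow)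
  qed
  moreover have "(c [^] d) [^] n \<in> H" for n :: int
    using d subgroup_int_pow_closed[OF H] by (simp add: D_def)
  ultimately have "H = range (\<lambda>n::int. (c [^] d) [^] n)"
    by blast
  then show ?thesis
    using d unfolding cyclic_subgroup[OF H] D_def by blast
qed

text \<open>Lift a generator of the image to \<open>t\<close> and use Bezout to replace it by a
  power \<open>t'\<close> that has the same image and is killed by \<open>m\<close>. A generator
  \<open>c\<close> of the kernel is killed by \<open>n\<close>. By coprimality both are powers of
  \<open>t' \<otimes> c\<close>, which therefore generates \<open>G\<close>.\<close>

lemma (in comm_group) cyclic_extension_coprime:
  fixes m n :: nat
  assumes "group_hom G K f" and "cyclic_group K" and "cyclic_group (G\<lparr>carrier := kernel G K f\<rparr>)"
    and "\<And>k. k \<in> carrier K \<Longrightarrow> k [^]\<^bsub>K\<^esub> m = \<one>\<^bsub>K\<^esub>"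
    and "\<And>x. x \<in> kernel G K f \<Longrightarrow> x [^] n = \<one>"
    and "coprime m n"
  shows "cyclic_group G"
proof -
  interpret f: group_hom G K f by fact
  \<comment> \<open>\<open>f\<close> need not be surjective: in the application it is restricted to
    a subgroup. Hence the generator is taken in the image, not in \<open>K\<close>.\<close>
  have "cyclic_group (K\<lparr>carrier := f ` carrier G\<rparr>)"
    using assms(2) f.img_is_subgroup f.H.subgroup_cyclic by blast
  then obtain y where "y \<in> f ` carrier G" and y: "f ` carrier G = range (\<lambda>r::int. y [^]\<^bsub>K\<^esub> r)"
    using f.H.cyclic_subgroup[OF f.img_is_subgroup] by blast
  then obtain t where t: "t \<in> carrier G" and "y = f t"
    by blast
  with y have img: "\<exists>r::int. f x = f t [^]\<^bsub>K\<^esub> r" if "x \<in> carrier G" for x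
    using that by blast
  obtain c where c: "c \<in> kernel G K f" and "kernel G K f = range (\<lambda>s::int. c [^] s)"
    using assms(3) cyclic_subgroup[OF f.subgroup_kernel] by blast
  then have ker: "\<exists>s::int. x = c [^] s" if "x \<in> kernel G K f" for x
    using that by blast
  have cG: "c \<in> carrier G"
    using c by (simp add: kernel_def)
  obtain u v where uv: "u * int m + v * int n = 1"
    using assms(6) bezout_int[of "int m" "int n"] by (metis coprime_imp_gcd_eq_1 coprime_int_iff)
  have cn: "c [^] (int n * k) = \<one>" for k
    using assms(5)[OF c] cG by (simp add: int_pow_int flip: int_pow_pow)
  have tm: "t [^] (int m * int n * k) = \<one>" for k
  proof -
    \<comment> \<open>The image of \<open>t\<close> is killed by \<open>m\<close>, so
      \<open>t [^] m\<close> lies in the kernel, which is killed by \<open>n\<close>.\<close>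
    have "t [^] m \<in> kernel G K f"
      using t assms(4)[of "f t"] by (simp add: kernel_def f.hom_nat_pow)
    then have "(t [^] m) [^] n = \<one>"
      by (rule assms(5))
    then show ?thesis
      using t by (simp add: int_pow_int nat_pow_pow flip: int_pow_pow of_nat_mult)
  qed
  \<comment> \<open>the component of \<open>t\<close> of order dividing \<open>m\<close>\<close>
  define t' where "t' = t [^] (int n * v)"
  define w where "w = t' \<otimes> c"
  have t': "t' \<in> carrier G" and w: "w \<in> carrier G"
    using t cG by (simp_all add: t'_def w_def)
  \<comment> \<open>By Bezout, \<open>int n * v\<close> is 1 modulo \<open>m\<close>, and
    \<open>f t\<close> is killed by \<open>m\<close>.\<close>
  have ft': "f t' = f t"
  proof -
    have "f t [^]\<^bsub>K\<^esub> (int m * u) = \<one>\<^bsub>K\<^esub>"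
      using assms(4)[of "f t"] t by (simp add: int_pow_int flip: f.H.int_pow_pow)
    moreover have "f t [^]\<^bsub>K\<^esub> (int m * u + int n * v) = f t"
      using uv t by (simp add: mult.commute)
    ultimately show ?thesis
      using t by (simp add: t'_def f.hom_int_pow f.H.int_pow_mult)
  qed
  have t'm: "t' [^] (int m * u) = \<one>"
    using tm[of "v * u"] t by (simp add: t'_def int_pow_pow mult_ac)
  \<comment> \<open>The two Bezout summands act as projections: \<open>int m * u\<close> kills
    \<open>t'\<close> and fixes \<open>c\<close>, while \<open>int n * v\<close> fixes
    \<open>t'\<close> and kills \<open>c\<close>.\<close>
  have wc: "w [^] (int m * u) = c"
  proof -
    have "c [^] (int m * u) = c"
      using cn[of v] cG uv int_pow_mult[OF cG, of "int m * u" "int n * v"] by (simp add: mult.commute)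
    then show ?thesis
      using t' cG t'm by (simp add: w_def int_pow_distrib)
  qed
  have wt: "w [^] (int n * v) = t'"
  proof -
    have "t' [^] (int n * v) = t'"
      using t' t'm uv int_pow_mult[OF t', of "int m * u" "int n * v"] by (simp add: mult.commute)
    then show ?thesis
      using t' cG cn[of v] by (simp add: w_def int_pow_distrib)
  qed
  have "\<exists>k::int. x = w [^] k" if x: "x \<in> carrier G" for x
  proof -
    obtain r :: int where r: "f x = f t [^]\<^bsub>K\<^esub> r"
      using img[OF x] by blast
    \<comment> \<open>A power of \<open>t'\<close> matches the image of \<open>x\<close>, and the
      remaining factor is a power of \<open>c\<close>.\<close>
    have "inv (t' [^] r) \<otimes> x \<in> kernel G K f"
      using x t t' r by (simp add: kernel_def ft' f.hom_int_pow)
    then obtain s :: int where s: "inv (t' [^] r) \<otimes> x = c [^] s"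
      using ker by blast
    have "x = t' [^] r \<otimes> c [^] s"
      using x t' by (simp flip: s m_assoc)
    also have "\<dots> = w [^] (int n * v * r + int m * u * s)"
      by (simp add: int_pow_mult w wc wt flip: int_pow_pow)
    finally show ?thesis by blast
  qed
  then have "carrier G = range (\<lambda>k::int. w [^] k)"
    using w int_pow_closed by blast
  then show ?thesis
    unfolding cyclic_group using w by blast
qed

section \<open>Effective cyclicity\<close>

lemma (in group) subgroup_common_centralizer:
  assumes "S \<subseteq> carrier G"
  shows "subgroup {h \<in> carrier G. \<forall>s\<in>S. h \<otimes> s = s \<otimes> h} G"
proof (rule subgroupI)
  fix x
  assume x: "x \<in> {h \<in> carrier G. \<forall>s\<in>S. h \<otimes> s = s \<otimes> h}"
  have "inv x \<otimes> s = s \<otimes> inv x" if "s \<in> S" for s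
  proof -
    have "s \<in> carrier G" "x \<in> carrier G" "x \<otimes> s = s \<otimes> x"
      using x that assms by auto
    then show ?thesis
      by (metis inv_closed inv_solve_left inv_solve_right m_assoc m_closed)
  qed
  then show "inv x \<in> {h \<in> carrier G. \<forall>s\<in>S. h \<otimes> s = s \<otimes> h}"
    using x by simp
next
  fix x y
  assume "x \<in> {h \<in> carrier G. \<forall>s\<in>S. h \<otimes> s = s \<otimes> h}"
    and "y \<in> {h \<in> carrier G. \<forall>s\<in>S. h \<otimes> s = s \<otimes> h}"
  then show "x \<otimes> y \<in> {h \<in> carrier G. \<forall>s\<in>S. h \<otimes> s = s \<otimes> h}"
    using assms by (auto simp: subset_eq) (metis m_assoc)
qed (use assms in \<open>auto intro!: exI[of _ \<one>]\<close>)

text \<open>The double centralizer is used in place of the generated subgroup: its elements commute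
  by definition with everything in \<open>Z {g, h}\<close>, so no induction over products is
  needed.\<close>

lemma (in group) commuting_in_abelian_subgroup:
  assumes "g \<in> carrier G" "h \<in> carrier G" "h \<otimes> g = g \<otimes> h"
  obtains A where "subgroup A G" "comm_group (G\<lparr>carrier := A\<rparr>)" "g \<in> A" "h \<in> A"
proof -
  define Z where "Z S = {h \<in> carrier G. \<forall>s\<in>S. h \<otimes> s = s \<otimes> h}" for S
  define A where "A = Z (Z {g, h})"
  have "subgroup A G"
    unfolding A_def Z_def by (rule subgroup_common_centralizer) auto
  moreover have gh: "{g, h} \<subseteq> A" and "{g, h} \<subseteq> Z {g, h}"
    using assms by (auto simp: A_def Z_def)
  \<comment> \<open>\<open>Z\<close> reverses inclusions, so \<open>A\<close> lies in the set that
    it centralizes and is abelian.\<close>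
  then have "A \<subseteq> Z {g, h}"
    by (auto simp: A_def Z_def)
  then have "x \<otimes> y = y \<otimes> x" if "x \<in> A" "y \<in> A" for x y
    using that by (auto simp: A_def Z_def)
  ultimately show thesis
    using that[of A] gh group.group_comm_groupI[OF subgroup_imp_group[of A]] by auto
qed

text \<open>Although \<open>G\<close> need not be abelian, \<open>cyclic_extension_coprime\<close>
  applies to the restriction of \<open>f\<close> to any abelian subgroup \<open>A\<close>. The
  restricted kernel is a subgroup of the cyclic kernel of \<open>f\<close>, hence cyclic, and both
  exponent conditions are inherited.\<close>

lemma (in group) effectively_cyclicI:
  fixes m n :: nat
  assumes "finite (carrier G)"
    and "group_hom G K f" and "cyclic_group K" and "cyclic_group (G\<lparr>carrier := kernel G K f\<rparr>)"
    and "\<And>k. k \<in> carrier K \<Longrightarrow> k [^]\<^bsub>K\<^esub> m = \<one>\<^bsub>K\<^esub>"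
    and "\<And>x. x \<in> kernel G K f \<Longrightarrow> x [^] n = \<one>"
    and "coprime m n"
  shows "effectively_cyclic G"
proof -
  interpret f: group_hom G K f by fact
  have "cyclic_group (G\<lparr>carrier := A\<rparr>)" if A: "subgroup A G" and "comm_group (G\<lparr>carrier := A\<rparr>)" for A
  proof -
    interpret A: comm_group "G\<lparr>carrier := A\<rparr>" by fact
    have AG: "A \<subseteq> carrier G"
      using A by (rule subgroup.subset)
    have ker: "kernel (G\<lparr>carrier := A\<rparr>) K f = kernel G K f \<inter> A"
      using AG by (auto simp: kernel_def)
    have hom: "group_hom (G\<lparr>carrier := A\<rparr>) K f"
      using AG by unfold_locales (auto simp: hom_def subset_eq)
    have sub: "subgroup (kernel G K f \<inter> A) (G\<lparr>carrier := kernel G K f\<rparr>)"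
      using A f.subgroup_kernel subgroups_Inter_pair subgroup_incl by blast
    interpret N: group "G\<lparr>carrier := kernel G K f\<rparr>"
      using f.subgroup_kernel subgroup_imp_group by blast
    have "cyclic_group (G\<lparr>carrier := kernel G K f \<inter> A\<rparr>)"
      using N.subgroup_cyclic[OF assms(4) sub] by simp
    then show ?thesis
      using A.cyclic_extension_coprime[OF hom assms(3) _ assms(5) _ assms(7)] assms(6)
      by (simp add: ker nat_pow_consistent[symmetric])
  qed
  then show ?thesis
    unfolding effectively_cyclic_def centralizer_def
    using assms(1) is_group commuting_in_abelian_subgroup by (smt (verit, best) mem_Collect_eq)
qed

section \<open>Group presentations\<close>

text \<open>Evaluation is defined on words rather than on classes, so no representatives have to be
  chosen; \<open>word_value_cong\<close> shows when it respects equivalence.\<close>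

definition word_value :: "('a, 'm) monoid_scheme \<Rightarrow> ('g \<Rightarrow> 'a) \<Rightarrow> 'g word \<Rightarrow> 'a" where
  "word_value G \<gamma> w =
     foldr (\<lambda>(x, b) y. (if b then \<gamma> x else inv\<^bsub>G\<^esub> \<gamma> x) \<otimes>\<^bsub>G\<^esub> y) w \<one>\<^bsub>G\<^esub>"

context group
begin

lemma word_value_Nil [simp]: "word_value G \<gamma> [] = \<one>"
  by (simp add: word_value_def)

lemma word_value_Cons [simp]:
  "word_value G \<gamma> ((x, b) # w) = (if b then \<gamma> x else inv \<gamma> x) \<otimes> word_value G \<gamma> w"
  by (simp add: word_value_def)

lemma word_value_closed [simp]:
  assumes "range \<gamma> \<subseteq> carrier G"
  shows "word_value G \<gamma> w \<in> carrier G"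
  using assms by (induction w) (auto simp: image_subset_iff)

lemma word_value_append:
  assumes "range \<gamma> \<subseteq> carrier G"
  shows "word_value G \<gamma> (u @ v) = word_value G \<gamma> u \<otimes> word_value G \<gamma> v"
  using assms by (induction u) (auto simp: image_subset_iff m_assoc)

text \<open>Used in the semidirect product and also in the presented group, where it identifies the
  class of \<open>word_pow x n\<close> with a power of the class of the generator.\<close>

lemma word_value_pow:
  assumes "range \<gamma> \<subseteq> carrier G"
  shows "word_value G \<gamma> (word_pow x n) = \<gamma> x [^] n"
proof -
  have x: "\<gamma> x \<in> carrier G"
    using assms by auto
  have "word_value G \<gamma> (replicate k (x, True)) = \<gamma> x [^] k" for k :: nat
    using x by (induction k) (simp_all flip: nat_pow_Suc2)
  moreover have "word_value G \<gamma> (replicate k (x, False)) = inv \<gamma> x [^] k" for k :: nat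
    using x by (induction k) (simp_all flip: nat_pow_Suc2)
  ultimately show ?thesis
    unfolding word_pow_def int_pow_def2 using nat_pow_inv[OF x] by auto
qed

text \<open>This is how words are shown to be inequivalent: it suffices that they have different
  values in some group satisfying the relations.\<close>

lemma word_value_cong:
  assumes "word_eq R u v" and "range \<gamma> \<subseteq> carrier G"
    and "\<And>u v. (u, v) \<in> R \<Longrightarrow> word_value G \<gamma> u = word_value G \<gamma> v"
  shows "word_value G \<gamma> u = word_value G \<gamma> v"
  using assms(1)
proof induction
  case (cancel x b)
  then show ?case using assms(2) by (auto simp: image_subset_iff)
qed (use assms in \<open>auto simp: word_value_append\<close>)

end

lemma word_class_eq_iff: "word_class R u = word_class R v \<longleftrightarrow> word_eq R u v"
  unfolding word_class_def by (blast intro: word_eq.refl word_eq.sym word_eq.trans)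

lemma carrier_presented_group: "carrier (presented_group R) = range (word_class R)"
  by (simp add: presented_group_def)

lemma one_presented_group: "\<one>\<^bsub>presented_group R\<^esub> = word_class R []"
  by (simp add: presented_group_def)

lemma mult_presented_group:
  "word_class R u \<otimes>\<^bsub>presented_group R\<^esub> word_class R v = word_class R (u @ v)"
proof -
  have "word_class R (u' @ v') = word_class R (u @ v)"
    if "u' \<in> word_class R u" "v' \<in> word_class R v" for u' v'
    using that unfolding word_class_eq_iff
    by (auto simp: word_class_def intro: word_eq.append word_eq.sym)
  \<comment> \<open>Both index sets are inhabited, so the union of equal classes is that class and
    not empty.\<close>
  moreover have "u \<in> word_class R u" "v \<in> word_class R v"
    by (simp_all add: word_class_def word_eq.refl)
  ultimately have "(\<Union>u'\<in>word_class R u. \<Union>v'\<in>word_class R v. word_class R (u' @ v')) = word_class R (u @ v)"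
    by blast
  then show ?thesis
    by (simp add: presented_group_def)
qed

text \<open>The formal inverse reverses the word and flips each letter. The first letter of
  \<open>w\<close> meets its inverse in the middle, so cancelling there reduces to the tail.\<close>

lemma word_eq_cancel_inverse: "word_eq R (map (\<lambda>(x, b). (x, \<not> b)) (rev w) @ w) []"
proof (induction w)
  case Nil
  show ?case by (simp add: word_eq.refl)
next
  case (Cons l w)
  obtain x b where l: "l = (x, b)" by fastforce
  let ?i = "map (\<lambda>(x, b). (x, \<not> b)) (rev w)"
  have "word_eq R ([(x, \<not> b), (x, b)] @ w) ([] @ w)"
    using word_eq.cancel[of R x "\<not> b"] by (intro word_eq.append word_eq.refl) simp
  then have "word_eq R (?i @ [(x, \<not> b), (x, b)] @ w) (?i @ w)"
    using word_eq.append[OF word_eq.refl[of R ?i]] by simp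
  then show ?case
    using Cons.IH word_eq.trans by (fastforce simp: l)
qed

lemma group_presented_group: "group (presented_group R)"
proof (rule groupI)
  fix U
  assume "U \<in> carrier (presented_group R)"
  then obtain w where "U = word_class R w"
    by (auto simp: carrier_presented_group)
  then have V: "word_class R (map (\<lambda>(x, b). (x, \<not> b)) (rev w)) \<otimes>\<^bsub>presented_group R\<^esub> U
      = \<one>\<^bsub>presented_group R\<^esub>"
    by (simp add: mult_presented_group one_presented_group word_class_eq_iff word_eq_cancel_inverse)
  show "\<exists>V\<in>carrier (presented_group R). V \<otimes>\<^bsub>presented_group R\<^esub> U = \<one>\<^bsub>presented_group R\<^esub>"
    by (rule bexI, rule V) (simp add: carrier_presented_group)
qed (auto simp: carrier_presented_group one_presented_group mult_presented_group)

text \<open>Expresses that the classes of the generators generate the presented group, and lets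
  classes of words be computed by group operations.\<close>

lemma word_value_presented_group:
  "word_value (presented_group R) (\<lambda>x. word_class R [(x, True)]) w = word_class R w"
proof (induction w)
  case Nil
  show ?case by (simp add: word_value_def one_presented_group)
next
  case (Cons l w)
  obtain x b where l: "l = (x, b)" by fastforce
  interpret P: group "presented_group R" by (rule group_presented_group)
  have "inv\<^bsub>presented_group R\<^esub> word_class R [(x, True)] = word_class R [(x, False)]"
    using word_eq.cancel[of R x False]
    by (intro P.inv_equality)
      (auto simp: carrier_presented_group one_presented_group mult_presented_group word_class_eq_iff)
  then show ?case
    using Cons by (auto simp: l mult_presented_group)
qed

section \<open>The metacyclic group\<close>

lemma carrier_cyclic_semidirect:
  assumes "p > 0" "q > 0"
  shows "carrier (cyclic_semidirect q p \<phi>) = {0..<int q} \<times> {0..<int p}"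
  using assms by (simp add: cyclic_semidirect_def semidirect_product_def carrier_integer_mod_group)

lemma one_cyclic_semidirect [simp]: "\<one>\<^bsub>cyclic_semidirect q p \<phi>\<^esub> = (0, 0)"
  by (simp add: cyclic_semidirect_def semidirect_product_def)

lemma mult_cyclic_semidirect [simp]:
  "(x, i) \<otimes>\<^bsub>cyclic_semidirect q p \<phi>\<^esub> (y, j) = ((x + \<phi> ^ nat i * y) mod int q, (i + j) mod int p)"
  by (simp add: cyclic_semidirect_def semidirect_product_def mod_simps)

text \<open>Multiplication reduces the second coordinate modulo \<open>p\<close>; this makes the
  action insensitive to that reduction.\<close>

lemma cong_power_mod:
  fixes \<phi> :: int
  assumes "[\<phi> ^ p = 1] (mod int q)"
  shows "[\<phi> ^ (n mod p) = \<phi> ^ n] (mod int q)"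
proof -
  have "[(\<phi> ^ p) ^ (n div p) * \<phi> ^ (n mod p) = 1 ^ (n div p) * \<phi> ^ (n mod p)] (mod int q)"
    using assms by (intro cong_mult cong_pow cong_refl)
  moreover have "(\<phi> ^ p) ^ (n div p) * \<phi> ^ (n mod p) = \<phi> ^ n"
    by (simp flip: power_mult power_add)
  ultimately show ?thesis by (simp add: cong_sym)
qed

lemma group_cyclic_semidirect:
  assumes "p > 0" "q > 0" "[\<phi> ^ p = 1] (mod int q)"
  shows "group (cyclic_semidirect q p \<phi>)"
proof (rule groupI)
  fix g h k
  assume "g \<in> carrier (cyclic_semidirect q p \<phi>)" "h \<in> carrier (cyclic_semidirect q p \<phi>)"
    and "k \<in> carrier (cyclic_semidirect q p \<phi>)"
  then obtain x i y j z l where ghk: "g = (x, i)" "h = (y, j)" "k = (z, l)" and ij: "0 \<le> i" "0 \<le> j"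
    by (auto simp: carrier_cyclic_semidirect[OF assms(1,2)])
  have "nat ((i + j) mod int p) = (nat i + nat j) mod p"
    using ij by (simp add: nat_mod_distrib nat_add_distrib)
  \<comment> \<open>Associativity rests on this: modulo \<open>q\<close>, the reduced sum of
    \<open>i\<close> and \<open>j\<close> acts as the composition of their actions.\<close>
  then have "[\<phi> ^ nat ((i + j) mod int p) = \<phi> ^ nat i * \<phi> ^ nat j] (mod int q)"
    using cong_power_mod[OF assms(3), of "nat i + nat j"] by (simp add: power_add)
  then have "[(x + \<phi> ^ nat i * y) + \<phi> ^ nat ((i + j) mod int p) * z
      = (x + \<phi> ^ nat i * y) + \<phi> ^ nat i * \<phi> ^ nat j * z] (mod int q)"
    by (intro cong_add cong_mult cong_refl)
  moreover have "(x + \<phi> ^ nat i * ((y + \<phi> ^ nat j * z) mod int q)) mod int q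
      = (x + \<phi> ^ nat i * (y + \<phi> ^ nat j * z)) mod int q"
    by (metis mod_add_right_eq mod_mult_right_eq)
  ultimately show "g \<otimes>\<^bsub>cyclic_semidirect q p \<phi>\<^esub> h \<otimes>\<^bsub>cyclic_semidirect q p \<phi>\<^esub> k
      = g \<otimes>\<^bsub>cyclic_semidirect q p \<phi>\<^esub> (h \<otimes>\<^bsub>cyclic_semidirect q p \<phi>\<^esub> k)"
    by (simp add: ghk cong_def mod_simps distrib_left mult.assoc add.assoc)
next
  fix g :: "int \<times> int"
  obtain x i where g: "g = (x, i)"
    by fastforce
  \<comment> \<open>In a left inverse \<open>?j\<close> acts on \<open>x\<close> as multiplication
    by \<open>\<phi> ^ nat ?j\<close>, and the first coordinate is chosen to cancel the
    result.\<close>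
  let ?j = "(- i) mod int p"
  let ?h = "((- (\<phi> ^ nat ?j * x)) mod int q, ?j)"
  have "?h \<in> carrier (cyclic_semidirect q p \<phi>)"
    using assms by (simp add: carrier_cyclic_semidirect)
  moreover have "?h \<otimes>\<^bsub>cyclic_semidirect q p \<phi>\<^esub> g = \<one>\<^bsub>cyclic_semidirect q p \<phi>\<^esub>"
    by (simp add: g mod_simps)
  ultimately show "\<exists>h\<in>carrier (cyclic_semidirect q p \<phi>).
      h \<otimes>\<^bsub>cyclic_semidirect q p \<phi>\<^esub> g = \<one>\<^bsub>cyclic_semidirect q p \<phi>\<^esub>"
    by blast
qed (use assms in \<open>auto simp: carrier_cyclic_semidirect\<close>)

text \<open>The generator is \<open>1 mod int n\<close> because 1 itself is outside the carrier when
  \<open>n = 1\<close>. For \<open>n = 0\<close> the group is that of all integers.\<close>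

lemma cyclic_integer_mod_group: "cyclic_group (integer_mod_group n)"
proof -
  have "carrier (integer_mod_group n) = range (\<lambda>k::int. (1 mod int n) [^]\<^bsub>integer_mod_group n\<^esub> k)"
  proof (cases "n = 0")
    case False
    have "x \<in> range (\<lambda>k. k mod int n)" if "x \<in> {0..<int n}" for x
      using that by (intro image_eqI[of _ _ x]) auto
    then show ?thesis
      using False by (auto simp: int_pow_integer_mod_group carrier_integer_mod_group mod_simps)
  qed (auto simp: int_pow_integer_mod_group carrier_integer_mod_group)
  then show ?thesis
    unfolding group.cyclic_group[OF group_integer_mod_group]
    by (rule bexI) (auto simp: carrier_integer_mod_group)
qed

lemma hom_normal_factor:
  assumes "p > 0" "q > 0"
  shows "(\<lambda>x. (x, 0)) \<in> hom (integer_mod_group q) (cyclic_semidirect q p \<phi>)"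
  using assms by (auto simp: hom_def carrier_cyclic_semidirect carrier_integer_mod_group)

lemma hom_complement:
  assumes "p > 0" "q > 0"
  shows "(\<lambda>i. (0, i)) \<in> hom (integer_mod_group p) (cyclic_semidirect q p \<phi>)"
  using assms by (auto simp: hom_def carrier_cyclic_semidirect carrier_integer_mod_group)

lemma hom_projection:
  assumes "p > 0" "q > 0"
  shows "snd \<in> hom (cyclic_semidirect q p \<phi>) (integer_mod_group p)"
  using assms by (auto simp: hom_def carrier_cyclic_semidirect carrier_integer_mod_group)

text \<open>The power is computed in \<open>integer_mod_group q\<close> and carried over by the
  inclusion of the normal factor.\<close>

lemma cyclic_semidirect_pow_a:
  assumes "p > 0" "q > 0" "[\<phi> ^ p = 1] (mod int q)"
  shows "(1 mod int q, 0) [^]\<^bsub>cyclic_semidirect q p \<phi>\<^esub> (n::int) = (n mod int q, 0)"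
  using hom_int_pow[OF hom_normal_factor[OF assms(1,2)], of "1 mod int q" \<phi> n]
    group_cyclic_semidirect[OF assms] assms
  by (simp add: int_pow_integer_mod_group carrier_integer_mod_group mod_simps)

lemma cyclic_semidirect_pow_A:
  assumes "p > 0" "q > 0" "[\<phi> ^ p = 1] (mod int q)"
  shows "(0, 1 mod int p) [^]\<^bsub>cyclic_semidirect q p \<phi>\<^esub> (n::int) = (0, n mod int p)"
  using hom_int_pow[OF hom_complement[OF assms(1,2)], of "1 mod int p" \<phi> n]
    group_cyclic_semidirect[OF assms] assms
  by (simp add: int_pow_integer_mod_group carrier_integer_mod_group mod_simps)

text \<open>The criterion \<open>effectively_cyclicI\<close> is applied to the projection onto the
  second factor: its target is cyclic of exponent \<open>p\<close>, and its kernel is a copy of the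
  cyclic group of order \<open>q\<close>.\<close>

lemma effectively_cyclic_semidirect:
  assumes "p > 0" "q > 0" "coprime p q" "[\<phi> ^ p = 1] (mod int q)"
  shows "effectively_cyclic (cyclic_semidirect q p \<phi>)"
proof -
  let ?G = "cyclic_semidirect q p \<phi>"
  let ?K = "integer_mod_group p"
  let ?N = "integer_mod_group q"
  interpret G: group ?G
    using assms by (intro group_cyclic_semidirect)
  interpret f: group_hom ?G ?K snd
    using assms by (simp add: group_hom_def group_hom_axioms_def hom_projection G.is_group)
  have ker: "kernel ?G ?K snd = (\<lambda>x. (x, 0)) ` carrier ?N"
    using assms by (auto simp: kernel_def carrier_cyclic_semidirect carrier_integer_mod_group)
  have "(\<lambda>x. (x, 0)) \<in> epi ?N (?G\<lparr>carrier := kernel ?G ?K snd\<rparr>)"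
    using hom_normal_factor[OF assms(1,2), of \<phi>] by (auto simp: epi_def hom_def ker)
  then have "cyclic_group (?G\<lparr>carrier := kernel ?G ?K snd\<rparr>)"
    using group.cyclic_group_epimorphic_image[OF group_integer_mod_group _ cyclic_integer_mod_group]
      G.subgroup_imp_group[OF f.subgroup_kernel] by blast
  moreover have "x [^]\<^bsub>?G\<^esub> q = \<one>\<^bsub>?G\<^esub>" if x: "x \<in> kernel ?G ?K snd" for x
  proof -
    obtain y where y: "y \<in> carrier ?N" "x = (y, 0)"
      using x unfolding ker by blast
    interpret g: group_hom ?N ?G "\<lambda>x. (x, 0)"
      using assms by (simp add: group_hom_def group_hom_axioms_def hom_normal_factor G.is_group)
    show ?thesis
      using g.hom_nat_pow[OF y(1), of q] y(2) by simp
  qed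
  ultimately show ?thesis
    using assms f.group_hom_axioms
    by (intro G.effectively_cyclicI[where K = ?K and f = snd and m = p and n = q])
      (auto simp: carrier_cyclic_semidirect cyclic_integer_mod_group)
qed

section \<open>Comparison with the presentation\<close>

text \<open>Conjugation by \<open>b\<close> is an endomorphism, so it multiplies every exponent of
  \<open>a\<close> by \<open>\<phi>\<close>; iterating gives the rule for moving powers of
  \<open>b\<close> to the right. The exponent of \<open>b\<close> is natural so that
  \<open>\<phi> ^ n\<close> is an integer.\<close>

lemma (in group) conj_int_pow:
  assumes "a \<in> carrier G" "b \<in> carrier G" "b \<otimes> a \<otimes> inv b = a [^] (\<phi>::int)"
  shows "b [^] (n::nat) \<otimes> a [^] (x::int) = a [^] (\<phi> ^ n * x) \<otimes> b [^] n"
proof -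
  interpret c: group_hom G G "\<lambda>x. b \<otimes> x \<otimes> inv b"
  proof unfold_locales
    show "(\<lambda>x. b \<otimes> x \<otimes> inv b) \<in> hom G G"
      using assms(2) by (auto simp: hom_def m_assoc) (simp add: inv_solve_left' flip: m_assoc)
  qed
  have step: "b \<otimes> a [^] x = a [^] (\<phi> * x) \<otimes> b" for x :: int
    using c.hom_int_pow[OF assms(1), of x] assms
    by (simp add: int_pow_pow inv_solve_right')
  show ?thesis
  proof (induction n arbitrary: x)
    case 0
    then show ?case using assms by simp
  next
    case (Suc n)
    have "b [^] Suc n \<otimes> a [^] x = b [^] n \<otimes> a [^] (\<phi> * x) \<otimes> b"
      using assms step[of x] by (simp add: m_assoc)
    also have "\<dots> = a [^] (\<phi> ^ Suc n * x) \<otimes> b [^] Suc n"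
      using assms Suc[of "\<phi> * x"] by (simp add: m_assoc mult_ac)
    finally show ?case .
  qed
qed

lemma (in group) int_pow_mod:
  assumes "a \<in> carrier G" "a [^] int n = \<one>"
  shows "a [^] (k mod int n) = a [^] k"
proof -
  have "a [^] k = a [^] (int n * (k div int n)) \<otimes> a [^] (k mod int n)"
    using assms(1) by (simp flip: int_pow_mult)
  then show ?thesis
    using assms by (simp flip: int_pow_pow)
qed

text \<open>Collecting powers of \<open>a\<close> on the left in a product of two normal forms
  reproduces the semidirect multiplication, up to reductions modulo \<open>q\<close> and
  \<open>p\<close> that the relations absorb.\<close>

lemma (in group) hom_cyclic_semidirect:
  assumes "p > 0" "q > 0" "a \<in> carrier G" "b \<in> carrier G"
    and "a [^] int q = \<one>" "b [^] int p = \<one>" "b \<otimes> a \<otimes> inv b = a [^] \<phi>"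
  shows "(\<lambda>(x, i). a [^] x \<otimes> b [^] i) \<in> hom (cyclic_semidirect q p \<phi>) G"
proof (rule homI; clarify)
  fix x i y j
  assume xi: "(x, i) \<in> carrier (cyclic_semidirect q p \<phi>)"
    and yj: "(y, j) \<in> carrier (cyclic_semidirect q p \<phi>)"
  \<comment> \<open>The coordinate is nonnegative, so \<open>conj_int_pow\<close> with its natural
    exponent applies.\<close>
  have i: "int (nat i) = i"
    using xi by (simp add: carrier_cyclic_semidirect[OF assms(1,2)])
  have "a [^] x \<otimes> b [^] i \<otimes> (a [^] y \<otimes> b [^] j) = a [^] x \<otimes> (b [^] i \<otimes> a [^] y) \<otimes> b [^] j"
    using assms by (simp add: m_assoc)
  also have "b [^] i \<otimes> a [^] y = a [^] (\<phi> ^ nat i * y) \<otimes> b [^] i"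
    using conj_int_pow[OF assms(3,4,7), of "nat i" y] by (metis i int_pow_int)
  finally have "a [^] x \<otimes> b [^] i \<otimes> (a [^] y \<otimes> b [^] j) = a [^] (x + \<phi> ^ nat i * y) \<otimes> b [^] (i + j)"
    using assms by (simp add: int_pow_mult m_assoc)
  then show "(case (x, i) \<otimes>\<^bsub>cyclic_semidirect q p \<phi>\<^esub> (y, j) of (x, i) \<Rightarrow> a [^] x \<otimes> b [^] i)
      = a [^] x \<otimes> b [^] i \<otimes> (a [^] y \<otimes> b [^] j)"
    using assms by (simp add: int_pow_mod)
qed (use assms in auto)

text \<open>The isomorphism is built from the semidirect product to the presented group, so
  evaluation of words never has to be turned into a map on classes.\<close>

lemma metacyclic_presentation:
  assumes "p > 0" "q > 0" "[\<phi> ^ p = 1] (mod int q)"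
  shows "cyclic_semidirect q p \<phi> \<cong> presented_group (metacyclic_relations q p \<phi>)"
proof -
  let ?G = "cyclic_semidirect q p \<phi>"
  let ?R = "metacyclic_relations q p \<phi>"
  let ?P = "presented_group ?R"
  interpret G: group ?G
    using assms by (rule group_cyclic_semidirect)
  interpret P: group ?P
    by (rule group_presented_group)
  define \<gamma> where "\<gamma> x = (case x of gen_a \<Rightarrow> (1 mod int q, 0) | gen_A \<Rightarrow> (0, 1 mod int p))" for x
  have \<gamma>_a: "\<gamma> gen_a = (1 mod int q, 0)" and \<gamma>_A: "\<gamma> gen_A = (0, 1 mod int p)"
    by (simp_all add: \<gamma>_def)
  have "\<gamma> x \<in> carrier ?G" for x
    using assms by (cases x) (simp_all add: \<gamma>_a \<gamma>_A carrier_cyclic_semidirect)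
  then have \<gamma>: "range \<gamma> \<subseteq> carrier ?G"
    by blast
  note pow_simps = G.word_value_pow[OF \<gamma>] \<gamma>_a \<gamma>_A cyclic_semidirect_pow_a[OF assms]
    cyclic_semidirect_pow_A[OF assms]
  have relations: "word_value ?G \<gamma> u = word_value ?G \<gamma> v" if "(u, v) \<in> ?R" for u v
  proof -
    \<comment> \<open>For \<open>p = 1\<close> the exponent \<open>1 mod p\<close> is 0; the
      congruence covers this case together with the others.\<close>
    have "[\<phi> ^ (1 mod p) = \<phi> ^ 1] (mod int q)"
      using assms(3) by (rule cong_power_mod)
    then have "\<phi> ^ nat (1 mod int p) * (1 mod int q) mod int q = \<phi> mod int q"
      by (simp add: cong_def nat_mod_distrib mod_simps)
    then have "\<gamma> gen_A \<otimes>\<^bsub>?G\<^esub> \<gamma> gen_a = (\<phi> mod int q, 0) \<otimes>\<^bsub>?G\<^esub> \<gamma> gen_A"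
      by (simp add: \<gamma>_a \<gamma>_A)
    moreover have "(\<phi> mod int q, 0) \<in> carrier ?G" "\<gamma> gen_a \<in> carrier ?G" "\<gamma> gen_A \<in> carrier ?G"
      using assms \<gamma> by (auto simp: carrier_cyclic_semidirect)
    ultimately have "\<gamma> gen_A \<otimes>\<^bsub>?G\<^esub> (\<gamma> gen_a \<otimes>\<^bsub>?G\<^esub> inv\<^bsub>?G\<^esub> \<gamma> gen_A) = (\<phi> mod int q, 0)"
      by (metis G.inv_closed G.inv_solve_right' G.m_assoc G.m_closed)
    then have "word_value ?G \<gamma> [(gen_A, True), (gen_a, True), (gen_A, False)]
        = word_value ?G \<gamma> (word_pow gen_a \<phi>)"
      using \<gamma> by (simp add: pow_simps(1,2,4) image_subset_iff del: one_cyclic_semidirect)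
    moreover have "word_value ?G \<gamma> (word_pow gen_a (int q)) = word_value ?G \<gamma> []"
      and "word_value ?G \<gamma> (word_pow gen_A (int p)) = word_value ?G \<gamma> []"
      by (simp_all add: pow_simps)
    ultimately show ?thesis
      using that unfolding metacyclic_relations_def by blast
  qed
  define a where "a = word_class ?R [(gen_a, True)]"
  define A where "A = word_class ?R [(gen_A, True)]"
  let ?cl = "\<lambda>x. word_class ?R [(x, True)]"
  have cl: "range ?cl \<subseteq> carrier ?P"
    by (auto simp: carrier_presented_group)
  have aA: "a \<in> carrier ?P" "A \<in> carrier ?P"
    by (simp_all add: a_def A_def carrier_presented_group)
  have pow_a: "a [^]\<^bsub>?P\<^esub> n = word_class ?R (word_pow gen_a n)"
    and pow_A: "A [^]\<^bsub>?P\<^esub> n = word_class ?R (word_pow gen_A n)" for n :: int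
    using P.word_value_pow[OF cl] by (simp_all add: a_def A_def word_value_presented_group)
  have "a [^]\<^bsub>?P\<^esub> int q = \<one>\<^bsub>?P\<^esub>" "A [^]\<^bsub>?P\<^esub> int p = \<one>\<^bsub>?P\<^esub>"
    unfolding pow_a pow_A one_presented_group word_class_eq_iff
    by (rule word_eq.relation; simp add: metacyclic_relations_def)+
  moreover have "A \<otimes>\<^bsub>?P\<^esub> a \<otimes>\<^bsub>?P\<^esub> inv\<^bsub>?P\<^esub> A = a [^]\<^bsub>?P\<^esub> \<phi>"
  proof -
    have "word_class ?R [(gen_A, True), (gen_a, True), (gen_A, False)] = word_class ?R (word_pow gen_a \<phi>)"
      unfolding word_class_eq_iff by (rule word_eq.relation) (simp add: metacyclic_relations_def)
    moreover have "A \<otimes>\<^bsub>?P\<^esub> (a \<otimes>\<^bsub>?P\<^esub> inv\<^bsub>?P\<^esub> A)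
        = word_class ?R [(gen_A, True), (gen_a, True), (gen_A, False)]"
      using aA word_value_presented_group[of ?R "[(gen_A, True), (gen_a, True), (gen_A, False)]"]
      by (simp add: a_def A_def)
    ultimately show ?thesis
      using aA by (simp add: pow_a P.m_assoc)
  qed
  ultimately have "(\<lambda>(x, i). a [^]\<^bsub>?P\<^esub> x \<otimes>\<^bsub>?P\<^esub> A [^]\<^bsub>?P\<^esub> i) \<in> hom ?G ?P" (is "?h \<in> _")
    using assms aA by (intro P.hom_cyclic_semidirect)
  then interpret h: group_hom ?G ?P ?h
    by unfold_locales
  \<comment> \<open>Evaluation recovers the pair from its normal form word, so equivalent normal
    forms come from equal pairs. This yields injectivity.\<close>
  have normal_form: "word_value ?G \<gamma> (word_pow gen_a x @ word_pow gen_A i) = (x, i)"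
    if "(x, i) \<in> carrier ?G" for x i
    using that assms
    by (simp add: G.word_value_append[OF \<gamma>] pow_simps carrier_cyclic_semidirect)
  have "inj_on ?h (carrier ?G)"
  proof (rule inj_onI; clarify)
    fix x i y j
    assume xi: "(x, i) \<in> carrier ?G" and yj: "(y, j) \<in> carrier ?G"
      and "a [^]\<^bsub>?P\<^esub> x \<otimes>\<^bsub>?P\<^esub> A [^]\<^bsub>?P\<^esub> i = a [^]\<^bsub>?P\<^esub> y \<otimes>\<^bsub>?P\<^esub> A [^]\<^bsub>?P\<^esub> j"
    then have "word_eq ?R (word_pow gen_a x @ word_pow gen_A i) (word_pow gen_a y @ word_pow gen_A j)"
      by (simp add: pow_a pow_A mult_presented_group word_class_eq_iff)
    from G.word_value_cong[OF this \<gamma> relations] show "x = y \<and> i = j"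
      by (simp add: normal_form[OF xi] normal_form[OF yj])
  qed
  moreover have "carrier ?P \<subseteq> ?h ` carrier ?G"
  proof -
    interpret I: subgroup "?h ` carrier ?G" ?P
      by (rule h.img_is_subgroup)
    \<comment> \<open>The coordinates of the generators are reduced residues of 1;
      \<open>int_pow_mod\<close> removes the reduction.\<close>
    have "?h (\<gamma> gen_a) = a" "?h (\<gamma> gen_A) = A"
      using aA P.int_pow_mod[OF aA(1) \<open>a [^]\<^bsub>?P\<^esub> int q = \<one>\<^bsub>?P\<^esub>\<close>, of 1]
        P.int_pow_mod[OF aA(2) \<open>A [^]\<^bsub>?P\<^esub> int p = \<one>\<^bsub>?P\<^esub>\<close>, of 1]
      by (simp_all add: \<gamma>_a \<gamma>_A)
    then have "?cl x = ?h (\<gamma> x)" for x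
      by (cases x) (simp_all add: a_def A_def)
    moreover have "?h (\<gamma> x) \<in> ?h ` carrier ?G" for x
      using \<gamma> by (intro imageI) auto
    ultimately have gen: "?cl x \<in> ?h ` carrier ?G" for x
      by (simp only:)
    \<comment> \<open>Each class is the value of its own word, so closure of the image under
      products and inverses gives surjectivity.\<close>
    have "word_value ?P ?cl w \<in> ?h ` carrier ?G" for w
    proof (induction w)
      case Nil
      show ?case
        unfolding P.word_value_Nil by (rule I.one_closed)
    next
      case (Cons l w)
      obtain x b where l: "l = (x, b)" by fastforce
      have "(if b then ?cl x else inv\<^bsub>?P\<^esub> ?cl x) \<in> ?h ` carrier ?G"
        using gen[of x] I.m_inv_closed[OF gen[of x]] by presburger
      then show ?case
        unfolding l P.word_value_Cons using Cons by (rule I.m_closed)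
    qed
    then show ?thesis
      unfolding word_value_presented_group carrier_presented_group by blast
  qed
  ultimately have "?h \<in> iso ?G ?P"
    using h.homh aA by (auto simp: iso_def bij_betw_def)
  then show ?thesis
    by (auto simp: is_iso_def)
qed

theorem theorem3p2:
  fixes p q :: nat and \<phi> :: int
  assumes "p > 0" and "q > 0" and "coprime p q"
    and "[\<phi> ^ p = 1] (mod int q)"
    and "gcd (\<phi> - 1) (int q) = 1 \<or> \<phi> = 1"
  shows "cyclic_semidirect q p \<phi> \<cong> presented_group (metacyclic_relations q p \<phi>)
    \<and> effectively_cyclic (cyclic_semidirect q p \<phi>)"
  using assms metacyclic_presentation effectively_cyclic_semidirect by blast

end
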